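(* Let $q$ be a prime power, let $n$ and $r$ be positive integers, let $t_1,\ldots,t_r$ be positive integers and put $\sigma=\frac{t_1t_2\cdots t_r}{\max\{t_1,\ldots,t_r\}}$. Suppose $\mathcal{D}$ is a family (set) of $r$-decompositions of $\mathbb{F}_q^n$ such that $\mathcal{D}_k$ is $t_k$-chain free for each $k\in\{1,\ldots,r\}$. Then $$\sum_{a_1+\cdots+a_r=n}\frac{|\mathcal{D}_{a_1,\ldots,a_r}|}{\genfrac{[}{]}{0pt}{}{n}{a_1,\ldots,a_r}_{q}\prod_{i<j}q^{a_ia_j}}\le\sigma,$$ where the sum is over all $r$-tuples of non-negative integers $(a_1,\ldots,a_r)$ with $a_1+\cdots+a_r=n$. Consequently, $$|\mathcal{D}|\le m_1+\cdots+m_\sigma,$$ where $m_1,\ldots,m_\sigma$ are the $\sigma$ largest values of $\genfrac{[}{]}{0pt}{}{n}{a_1,\ldots,a_r}_{q}\prod_{i<j}q^{a_ia_j}$ for non-negative integers $a_1,\ldots,a_r$ with $a_1+\cdots+a_r=n$.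
   Context: $\mathbb{F}_q$ is the finite field with $q$ elements and $L_q(n)$ is the lattice of all linear subspaces of $\mathbb{F}_q^n$ ordered by inclusion. A chain of length $t$ in $L_q(n)$ is a collection of $t+1$ (distinct) subspaces that are pairwise comparable under inclusion. A family $\mathcal{A}\subseteq L_q(n)$ is $t$-chain free if it contains no chain of length $t$. An $r$-decomposition of $\mathbb{F}_q^n$ is an $r$-tuple $(D_1,\ldots,D_r)$ of (possibly zero) subspaces in $L_q(n)$ with $D_1\oplus\cdots\oplus D_r=\mathbb{F}_q^n$ (internal direct sum). For a family $\mathcal{D}$ of $r$-decompositions, $\mathcal{D}_k=\{D_k\mid(D_1,\ldots,D_k,\ldots,D_r)\in\mathcal{D}\}$ for $k\in\{1,\ldots,r\}$, and for non-negative integers $a_1,\ldots,a_r$ with $a_1+\cdots+a_r=n$, $\mathcal{D}_{a_1,\ldots,a_r}=\{(D_1,\ldots,D_r)\in\mathcal{D}\mid\dim(D_i)=a_i\text{ for all }i=1,\ldots,r\}$. The $q$-multinomial coefficient is $\genfrac{[}{]}{0pt}{}{n}{a_1,\ldots,a_r}_{q}=\frac{[n]_q!}{[a_1]_q!\cdots[a_r]_q!}$, where $[m]_q!=(q^m-1)(q^{m-1}-1)\cdots(q-1)$ and $[0]_q!=1$. The product $\prod_{i<j}$ is over $1\le i<j\le r$. The "$\sigma$ largest" values are taken from the list of values indexed by all tuples $(a_1,\ldots,a_r)$, i.e. counted with multiplicity (different tuples giving the same value count separately); if $\sigma$ exceeds the number of such tuples, the missing $m_i$ are set to $0$. *)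

theory Defs
  imports "HOL-Analysis.Cartesian_Space" "HOL-Library.Multiset"
begin

text \<open>
  The space \<open>\<bbbF>\<^sub>q\<^sup>n\<close> is the type \<open>'a ^ 'n\<close> over a finite field type \<open>'a\<close> with \<open>CARD('a) = q\<close>
  and \<open>CARD('n) = n\<close>; its linear subspaces are the sets satisfying \<open>vec.subspace\<close>.
  All \<open>r\<close>-tuples are lists of length \<open>r\<close>, so the index range \<open>1, \<dots>, r\<close> becomes \<open>0, \<dots>, r - 1\<close>.
\<close>

text \<open>The internal direct sum is rendered as existence and uniqueness of the decomposition of
  every vector.\<close>

definition is_decomposition :: "nat \<Rightarrow> ('a::field ^ 'n) set list \<Rightarrow> bool" where
  "is_decomposition r Ds \<longleftrightarrow>
     length Ds = r \<and> (\<forall>U \<in> set Ds. vec.subspace U) \<and>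
     (\<forall>v. \<exists>!vs. list_all2 (\<in>) vs Ds \<and> sum_list vs = v)"

text \<open>A chain of length \<open>t\<close> has \<open>t + 1\<close> members.\<close>

definition chain_free :: "nat \<Rightarrow> 'b set set \<Rightarrow> bool" where
  "chain_free t \<A> \<longleftrightarrow> \<not> (\<exists>C \<in> chains \<A>. card C = t + 1)"

definition component :: "'b list set \<Rightarrow> nat \<Rightarrow> 'b set" where
  "component \<D> k = (\<lambda>Ds. Ds ! k) ` \<D>"

definition with_dims :: "('a::field ^ 'n) set list set \<Rightarrow> nat list \<Rightarrow> ('a ^ 'n) set list set" where
  "with_dims \<D> a = {Ds \<in> \<D>. map vec.dim Ds = a}"

definition weak_compositions :: "nat \<Rightarrow> nat \<Rightarrow> nat list set" where
  "weak_compositions r n = {a. length a = r \<and> sum_list a = n}"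

lemma finite_weak_compositions: "finite (weak_compositions r n)"
proof (rule finite_subset)
  show "weak_compositions r n \<subseteq> {a. set a \<subseteq> {..n} \<and> length a = r}"
    using member_le_sum_list by (auto simp: weak_compositions_def)
qed (simp add: finite_lists_length_eq)

definition q_fact :: "nat \<Rightarrow> nat \<Rightarrow> real" where
  "q_fact q m = (\<Prod>i = 1..m. real q ^ i - 1)"

definition q_multinomial :: "nat \<Rightarrow> nat \<Rightarrow> nat list \<Rightarrow> real" where
  "q_multinomial q n a = q_fact q n / (\<Prod>i<length a. q_fact q (a ! i))"

definition weight :: "nat \<Rightarrow> nat \<Rightarrow> nat list \<Rightarrow> real" where
  "weight q n a = q_multinomial q n a * (\<Prod>j<length a. \<Prod>i<j. real q ^ (a ! i * a ! j))"

text \<open>The division is exact for nonempty \<open>ts\<close>, see \<open>real_sigma\<close>.\<close>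

definition sigma :: "nat list \<Rightarrow> nat" where
  "sigma ts = prod_list ts div Max (set ts)"

lemma real_sigma:
  assumes "ts \<noteq> []"
  shows "real (sigma ts) = real (prod_list ts) / real (Max (set ts))"
proof -
  have "Max (set ts) \<in> set ts"
    using assms by (intro Max_in) auto
  moreover have "x dvd prod_list ts" if "x \<in> set ts" for x :: nat
    using that by (induction ts) auto
  ultimately show ?thesis
    by (simp add: sigma_def real_of_nat_div)
qed

text \<open>The entry at (zero-based) position \<open>i\<close> when \<open>M\<close> is listed in decreasing order with
  multiplicity, and \<open>0\<close> once \<open>M\<close> is exhausted.\<close>

definition nth_largest :: "real multiset \<Rightarrow> nat \<Rightarrow> real" where
  "nth_largest M i =
     (if i < size M then rev (sorted_list_of_multiset M) ! i else 0)"

end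

theory Submission
  imports Defs
begin

text \<open>
  The inequality is proved by induction on \<open>r\<close>, splitting off \<open>D\<^sub>1\<close>. For a fixed \<open>D\<^sub>1 = U\<close> with
  \<open>dim U = a\<close> the remaining summands span one of at most \<open>q\<close> to the \<open>a (n - a)\<close> complements of
  \<open>U\<close>, and the induction hypothesis applies inside each complement; the sum over \<open>U\<close> is then
  bounded by the LYM inequality for \<open>t\<close>-chain free families of subspaces. When only one summand
  is left it is determined, so one index contributes no factor, and by symmetry of the weight this
  can be the index of the largest \<open>t\<close>. For the bound on the cardinality, the same inequality applied
  to the decompositions of fixed dimensions, whose components are antichains, shows that every
  summand on the left is at most \<open>1\<close>; a sum of weights with coefficients in \<open>[0, 1]\<close> adding up to
  at most \<open>\<sigma>\<close> is at most the sum of the \<open>\<sigma>\<close> largest weights.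
\<close>

section \<open>Counting vectors and complements over a finite field\<close>

lemma card_field_ge_2: "2 \<le> CARD('a::{field,finite})"
  using card_mono[of "UNIV :: 'a set" "{0, 1}"] by simp

text \<open>For \<open>x\<close> outside the span of \<open>B\<close>, each vector of the larger
  span is uniquely \<open>c *s x + v\<close> with \<open>v\<close> in the span of \<open>B\<close>,
  so every basis vector multiplies the count by the field size.\<close>

lemma card_span_independent:
  fixes B :: "('a::{field,finite} ^ 'n::finite) set"
  assumes "vec.independent B"
  shows "card (vec.span B) = CARD('a) ^ card B"
proof -
  have "finite B" by simp
  then show ?thesis using assms
  proof (induction B rule: finite_induct)
    case empty
    then show ?case by simp
  next
    case (insert x B)
    have ind: "vec.independent B" and x: "x \<notin> vec.span B"
      using insert.prems insert.hyps(2) by (auto simp: vec.independent_insert)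
    let ?f = "\<lambda>(c, v). c *s x + v"
    have "bij_betw ?f (UNIV \<times> vec.span B) (vec.span (insert x B))"
      unfolding bij_betw_def
    proof
      show "inj_on ?f (UNIV \<times> vec.span B)"
      proof (rule inj_onI, clarify)
        fix c d u v
        assume uv: "u \<in> vec.span B" "v \<in> vec.span B" and eq: "c *s x + u = d *s x + v"
        have diff: "(c - d) *s x = v - u"
          using eq by (simp add: vec.scale_left_diff_distrib algebra_simps)
        have "c = d"
        proof (rule ccontr)
          assume "c \<noteq> d"
          then have "x = inverse (c - d) *s ((c - d) *s x)"
            by (simp add: vec.scale_scale)
          also have "\<dots> = inverse (c - d) *s (v - u)"
            by (simp only: diff)
          also have "\<dots> \<in> vec.span B"
            by (intro vec.span_scale vec.span_diff uv)
          finally show False using x by simp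
        qed
        then show "c = d \<and> u = v" using eq by simp
      qed
      show "?f ` (UNIV \<times> vec.span B) = vec.span (insert x B)"
      proof (rule set_eqI, rule iffI)
        fix y
        assume "y \<in> ?f ` (UNIV \<times> vec.span B)"
        then show "y \<in> vec.span (insert x B)"
          by (auto simp: vec.span_insert) (metis add_diff_cancel_left')
      next
        fix y
        assume "y \<in> vec.span (insert x B)"
        then obtain k where "y - k *s x \<in> vec.span B" by (auto simp: vec.span_insert)
        then show "y \<in> ?f ` (UNIV \<times> vec.span B)"
          by (intro image_eqI[where x = "(k, y - k *s x)"]) auto
      qed
    qed
    then have "card (vec.span (insert x B)) = card ((UNIV :: 'a set) \<times> vec.span B)"
      by (simp add: bij_betw_same_card)
    also have "\<dots> = CARD('a) ^ card (insert x B)"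
      using insert.IH[OF ind] insert.hyps by (simp add: card_cartesian_product)
    finally show ?case .
  qed
qed

lemma card_subspace:
  fixes U :: "('a::{field,finite} ^ 'n::finite) set"
  assumes "vec.subspace U"
  shows "card U = CARD('a) ^ vec.dim U"
proof -
  obtain B where "vec.independent B" "vec.span B = U" "card B = vec.dim U"
    using vec.basis_subspace_exists[OF assms] by metis
  then show ?thesis using card_span_independent[of B] by simp
qed

lemma dim_span_Un_Int:
  fixes U W :: "('a::field ^ 'n::finite) set"
  assumes "vec.subspace U" "vec.subspace W"
  shows "vec.dim (vec.span (U \<union> W)) + vec.dim (U \<inter> W) = vec.dim U + vec.dim W"
proof -
  have "vec.span (U \<union> W) = {x + y |x y. x \<in> U \<and> y \<in> W}"
    using assms by (simp add: vec.span_Un vec.span_eq_iff[THEN iffD2] del: vec.span_eq_iff)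
  then show ?thesis using vec.dim_sums_Int[OF assms] by simp
qed

lemma dim_span_Union_le:
  fixes Us :: "('a::field ^ 'n::finite) set list"
  assumes "\<forall>U \<in> set Us. vec.subspace U"
  shows "vec.dim (vec.span (\<Union> (set Us))) \<le> sum_list (map vec.dim Us)"
  using assms
proof (induction Us)
  case Nil
  then show ?case by simp
next
  case (Cons U Us)
  let ?W = "vec.span (\<Union> (set Us))"
  have "vec.dim (vec.span (\<Union> (set (U # Us)))) \<le> vec.dim (vec.span (U \<union> ?W))"
    using vec.span_superset[of "\<Union> (set Us)"] by (intro vec.dim_subset vec.span_mono) auto
  also have "\<dots> \<le> vec.dim U + vec.dim ?W"
    using dim_span_Un_Int[of U ?W] Cons.prems by simp
  also have "\<dots> \<le> sum_list (map vec.dim (U # Us))"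
    using Cons by simp
  finally show ?case .
qed

text \<open>The ambient space \<open>V\<close> is a parameter because the induction on the number of
  summands continues inside a complement.\<close>

definition complements :: "('a::field ^ 'n) set \<Rightarrow> ('a ^ 'n) set \<Rightarrow> ('a ^ 'n) set set" where
  "complements V U = {W. vec.subspace W \<and> U \<inter> W = {0} \<and> vec.span (U \<union> W) = V}"

text \<open>After fixing a complement with basis \<open>B\<close>, any complement is the graph of a linear map into
  \<open>U\<close>, which is determined by its values on \<open>B\<close>.\<close>

lemma card_complements_le:
  fixes U V :: "('a::{field,finite} ^ 'n::finite) set"
  assumes U: "vec.subspace U"
  shows "card (complements V U) \<le> CARD('a) ^ (vec.dim U * (vec.dim V - vec.dim U))"
proof (cases "complements V U = {}")
  case True
  then show ?thesis by simp
next
  case False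
  then obtain W0 where W0: "vec.subspace W0" "U \<inter> W0 = {0}" "vec.span (U \<union> W0) = V"
    by (auto simp: complements_def)
  obtain B where B: "B \<subseteq> W0" "vec.span B = W0" "card B = vec.dim W0"
    using vec.basis_subspace_exists[OF W0(1)] by metis
  have cardB: "card B = vec.dim V - vec.dim U"
    using dim_span_Un_Int[OF U W0(1)] W0 B(3) by simp
  define f where "f W = (\<lambda>b\<in>B. SOME u. u \<in> U \<and> b + u \<in> W)" for W
  have f: "f W b \<in> U \<and> b + f W b \<in> W" if W: "W \<in> complements V U" and b: "b \<in> B" for W b
  proof -
    have "b \<in> V" using W0(3) B(1) b vec.span_superset by blast
    then have "b \<in> {x + y |x y. x \<in> vec.span U \<and> y \<in> vec.span W}"
      using W by (simp add: complements_def vec.span_Un)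
    then obtain u w where "u \<in> U" "w \<in> W" "b = u + w"
      using U W by (auto simp: complements_def vec.span_eq_iff[THEN iffD2])
    then have "- u \<in> U \<and> b + (- u) \<in> W"
      using U by (simp add: vec.subspace_neg)
    then have "\<exists>u. u \<in> U \<and> b + u \<in> W" by blast
    from someI_ex[OF this] show ?thesis using b by (simp add: f_def)
  qed
  have recover: "W = vec.span ((\<lambda>b. b + f W b) ` B)" if W: "W \<in> complements V U" for W
  proof -
    let ?S = "vec.span ((\<lambda>b. b + f W b) ` B)"
    have sW: "vec.subspace W" and int: "U \<inter> W = {0}" and V: "vec.span (U \<union> W) = V"
      using W by (auto simp: complements_def)
    have SW: "?S \<subseteq> W"
      by (rule vec.span_minimal) (use f[OF W] sW in auto)
    \<comment> \<open>As \<open>b = (b + f W b) - f W b\<close>, the sum of \<open>U\<close> and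
      \<open>?S\<close> contains \<open>B\<close>, hence \<open>W0\<close> and all of
      \<open>V\<close>. Since \<open>?S \<subseteq> W\<close> and \<open>W\<close> meets
      \<open>U\<close> only in 0, this forces \<open>?S = W\<close>.\<close>
    have "B \<subseteq> vec.span (U \<union> ?S)"
    proof
      fix b assume b: "b \<in> B"
      have "(b + f W b) - f W b \<in> vec.span (U \<union> ?S)"
        using b f[OF W b] by (intro vec.span_diff) (auto intro!: vec.span_base)
      then show "b \<in> vec.span (U \<union> ?S)" by simp
    qed
    then have "W0 \<subseteq> vec.span (U \<union> ?S)"
      using vec.span_minimal[of B] B(2) by simp
    then have "V \<subseteq> vec.span (U \<union> ?S)"
      unfolding W0(3)[symmetric] by (intro vec.span_minimal) (auto intro: vec.span_base)
    moreover have "W \<subseteq> V" using V vec.span_superset by blast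
    ultimately have WS: "W \<subseteq> {x + y |x y. x \<in> U \<and> y \<in> ?S}"
      using U by (auto simp: vec.span_Un vec.span_eq_iff[THEN iffD2])
    have "W \<subseteq> ?S"
    proof
      fix w assume w: "w \<in> W"
      then obtain u s where us: "u \<in> U" "s \<in> ?S" "w = u + s" using WS by blast
      have "w - s \<in> W" using w us(2) SW sW by (intro vec.subspace_diff) auto
      then have "u \<in> U \<inter> W" using us by simp
      then show "w \<in> ?S" using int us by simp
    qed
    then show ?thesis using SW by blast
  qed
  have "inj_on f (complements V U)"
    by (rule inj_onI) (metis recover)
  moreover have "f ` complements V U \<subseteq> B \<rightarrow>\<^sub>E U"
    using f by (force simp: f_def)
  ultimately have "card (complements V U) \<le> card (B \<rightarrow>\<^sub>E U)"
    by (intro card_inj_on_le) auto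
  also have "\<dots> = (CARD('a) ^ vec.dim U) ^ card B"
    by (simp add: card_PiE card_subspace[OF U])
  finally show ?thesis by (simp add: cardB power_mult)
qed

section \<open>Factorials in \<open>q\<close> and the LYM inequality for subspaces\<close>

lemma chain_free_mono: "chain_free t \<A> \<Longrightarrow> \<B> \<subseteq> \<A> \<Longrightarrow> chain_free t \<B>"
  by (auto simp: chain_free_def chains_def)

lemma q_fact_0 [simp]: "q_fact q 0 = 1"
  by (simp add: q_fact_def)

lemma q_fact_Suc: "q_fact q (Suc m) = (real q ^ Suc m - 1) * q_fact q m"
  by (simp add: q_fact_def mult.commute)

lemma q_fact_pos:
  assumes "2 \<le> q"
  shows "0 < q_fact q m"
  unfolding q_fact_def
proof (rule prod_pos)
  fix i assume "i \<in> {1..m}"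
  then have "1 < real q ^ i" using assms by (intro one_less_power) auto
  then show "0 < real q ^ i - 1" by simp
qed

text \<open>The probability that a random maximal flag between subspaces of dimensions \<open>a\<close> and \<open>n\<close>
  passes through a given subspace of dimension \<open>b\<close> in between.\<close>

definition flag_prob :: "nat \<Rightarrow> nat \<Rightarrow> nat \<Rightarrow> nat \<Rightarrow> real" where
  "flag_prob q n a b = q_fact q (b - a) * q_fact q (n - b) / q_fact q (n - a)"

text \<open>The quotient is the proportion of the vectors outside the bottom space that lie in the
  given \<open>b\<close>-dimensional space, which is the probability that the first step of the flag
  stays inside it.\<close>

lemma flag_prob_step:
  assumes "2 \<le> q" "a < b" "b \<le> n"
  shows "flag_prob q n a b = (real q ^ b - real q ^ a) / (real q ^ n - real q ^ a) * flag_prob q n (Suc a) b"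
proof -
  obtain i where i: "b = Suc (a + i)" using assms(2) less_iff_Suc_add by auto
  obtain j where j: "n = b + j" using assms(3) le_iff_add by auto
  have q: "real q ^ a \<noteq> 0" using assms(1) by simp
  have "(real q ^ b - real q ^ a) / (real q ^ n - real q ^ a)
      = (real q ^ a * (real q ^ Suc i - 1)) / (real q ^ a * (real q ^ Suc (i + j) - 1))"
    by (simp add: i j power_add algebra_simps)
  also have "\<dots> = (real q ^ Suc i - 1) / (real q ^ Suc (i + j) - 1)"
    using q by (rule mult_divide_mult_cancel_left)
  finally have 1: "(real q ^ b - real q ^ a) / (real q ^ n - real q ^ a)
      = (real q ^ Suc i - 1) / (real q ^ Suc (i + j) - 1)" .
  have 2: "b - a = Suc i" "b - Suc a = i" "n - b = j" "n - a = Suc (i + j)" "n - Suc a = i + j"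
    by (simp_all add: i j)
  show ?thesis unfolding 1 flag_prob_def 2 q_fact_Suc by simp
qed

text \<open>Averaging over the vectors \<open>x \<in> V - U\<close> conditions a random flag on its first step
  \<open>span (insert x U)\<close>.\<close>

lemma LYM_between:
  fixes U V :: "('a::{field,finite} ^ 'n::finite) set"
  assumes "vec.subspace U" "vec.subspace V" "U \<subseteq> V"
    and "chain_free t \<A>"
    and "\<And>W. W \<in> \<A> \<Longrightarrow> vec.subspace W \<and> U \<subseteq> W \<and> W \<subseteq> V"
  shows "(\<Sum>W\<in>\<A>. flag_prob CARD('a) (vec.dim V) (vec.dim U) (vec.dim W)) \<le> real t"
  using assms
proof (induction "vec.dim V - vec.dim U" arbitrary: U \<A> t)
  case 0
  then have "U = V"
    using vec.subspace_dim_equal by simp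
  then have sub: "\<A> \<subseteq> {V}" using 0 by auto
  show ?case
  proof (cases "V \<in> \<A>")
    case True
    then have A: "\<A> = {V}" using sub by blast
    \<comment> \<open>A single member is a chain of length 0, so a nonempty family is never 0-chain
      free.\<close>
    have "t \<noteq> 0"
    proof
      assume "t = 0"
      moreover have "{V} \<in> chains \<A>" by (simp add: A chains_def chain_subset_def)
      ultimately show False using 0(5) by (auto simp: chain_free_def)
    qed
    then show ?thesis
      using q_fact_pos[of "CARD('a)"] card_field_ge_2[where 'a = 'a]
      by (simp add: A \<open>U = V\<close> flag_prob_def)
  next
    case False
    then have "\<A> = {}" using sub by blast
    then show ?thesis by simp
  qed
next
  case (Suc d)
  let ?q = "CARD('a)" and ?n = "vec.dim V" and ?a = "vec.dim U"
  note q2 = card_field_ge_2[where 'a = 'a]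
  have lt: "?a < ?n" using Suc.hyps(2) by simp
  define N where "N = real ?q ^ ?n - real ?q ^ ?a"
  have "real ?q ^ ?a < real ?q ^ ?n" using lt q2 by (intro power_strict_increasing) auto
  then have Npos: "N > 0" by (simp add: N_def)
  have card_diff': "real (card (W - U)) = real ?q ^ vec.dim W - real ?q ^ ?a"
    if "vec.subspace W" "U \<subseteq> W" for W
    using that Suc.prems(1) card_mono[of W U]
    by (simp add: card_Diff_subset card_subspace of_nat_diff)
  \<comment> \<open>Every member now strictly contains \<open>U\<close>, so the first step of the
    flag can be averaged. The claim is general in \<open>\<B>\<close> and \<open>s\<close> because
    it serves \<open>\<A>\<close> with \<open>t\<close> as well as \<open>\<A> - {U}\<close> with
    \<open>t - 1\<close>.\<close>
  have main: "(\<Sum>W\<in>\<B>. flag_prob ?q ?n ?a (vec.dim W)) \<le> real s"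
    if free: "chain_free s \<B>" and sub: "\<B> \<subseteq> \<A>" and notin: "U \<notin> \<B>" for \<B> s
  proof -
    have \<B>: "vec.subspace W" "U \<subseteq> W" "W \<subseteq> V" if "W \<in> \<B>" for W
      using Suc.prems(5) that sub by auto
    \<comment> \<open>The summand does not depend on \<open>x\<close>, so the sum supplies the
      factor \<open>card (W - U)\<close>; \<open>N\<close> is the number of vectors in
      \<open>V - U\<close>.\<close>
    have "flag_prob ?q ?n ?a (vec.dim W)
        = (\<Sum>x\<in>W - U. flag_prob ?q ?n (Suc ?a) (vec.dim W)) / N" if W: "W \<in> \<B>" for W
    proof -
      have "U \<noteq> W" using W notin by blast
      then have "?a < vec.dim W"
        using vec.subspace_dim_equal[OF Suc.prems(1) \<B>(1)[OF W] \<B>(2)[OF W]] by force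
      moreover have "vec.dim W \<le> ?n" by (intro vec.dim_subset \<B> W)
      ultimately show ?thesis
        by (simp add: flag_prob_step[OF q2] card_diff'[OF \<B>(1,2)[OF W]] N_def)
    qed
    then have "(\<Sum>W\<in>\<B>. flag_prob ?q ?n ?a (vec.dim W))
        = (\<Sum>W\<in>\<B>. \<Sum>x\<in>W - U. flag_prob ?q ?n (Suc ?a) (vec.dim W)) / N"
      by (simp add: sum_divide_distrib)
    also have "(\<Sum>W\<in>\<B>. \<Sum>x\<in>W - U. flag_prob ?q ?n (Suc ?a) (vec.dim W))
        = (\<Sum>W\<in>\<B>. \<Sum>x | x \<in> V - U \<and> x \<in> W. flag_prob ?q ?n (Suc ?a) (vec.dim W))"
      using \<B>(3) by (intro sum.cong refl) auto
    also have "\<dots> = (\<Sum>x\<in>V - U. \<Sum>W | W \<in> \<B> \<and> x \<in> W. flag_prob ?q ?n (Suc ?a) (vec.dim W))"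
      by (rule sum.swap_restrict) auto
    also have "\<dots> \<le> (\<Sum>x\<in>V - U. real s)"
    proof (rule sum_mono)
      fix x assume x: "x \<in> V - U"
      let ?U' = "vec.span (insert x U)"
      have "x \<notin> vec.span U" using x Suc.prems(1) by (simp add: vec.span_eq_iff[THEN iffD2])
      then have dim: "vec.dim ?U' = Suc ?a" by (simp add: vec.dim_insert)
      \<comment> \<open>The members containing \<open>x\<close> all contain \<open>?U'\<close>,
        which has one dimension more than \<open>U\<close>, so the induction hypothesis applies with
        the same \<open>s\<close>.\<close>
      have "(\<Sum>W | W \<in> \<B> \<and> x \<in> W. flag_prob ?q ?n (vec.dim ?U') (vec.dim W)) \<le> real s"
      proof (rule Suc.hyps(1))
        show "d = ?n - vec.dim ?U'" using dim Suc.hyps(2) by simp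
        show "?U' \<subseteq> V" using x Suc.prems by (intro vec.span_minimal) auto
        show "chain_free s {W \<in> \<B>. x \<in> W}" using free by (rule chain_free_mono) auto
        show "vec.subspace W \<and> ?U' \<subseteq> W \<and> W \<subseteq> V" if "W \<in> {W \<in> \<B>. x \<in> W}" for W
          using that \<B> vec.span_minimal[of "insert x U" W] by blast
      qed (use Suc.prems in auto)
      then show "(\<Sum>W | W \<in> \<B> \<and> x \<in> W. flag_prob ?q ?n (Suc ?a) (vec.dim W)) \<le> real s"
        by (simp only: dim)
    qed
    also have "\<dots> = N * real s"
      using card_diff'[of V] Suc.prems by (simp add: N_def)
    finally show ?thesis using Npos by (simp add: divide_right_mono mult.commute field_simps)
  qed
  show ?case
  proof (cases "U \<in> \<A>")
    case False
    then show ?thesis using main[OF Suc.prems(4)] by simp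
  next
    case True
    have "t \<noteq> 0"
    proof
      assume "t = 0"
      moreover have "{U} \<in> chains \<A>" using True by (simp add: chains_def chain_subset_def)
      ultimately show False using Suc.prems(4) by (auto simp: chain_free_def)
    qed
    then obtain s where t: "t = Suc s" using not0_implies_Suc by blast
    \<comment> \<open>\<open>U\<close> lies below all members and extends any chain of the others by
      one. Removing it lowers the bound by 1, which is exactly its own term in the sum.\<close>
    have "chain_free s (\<A> - {U})"
      unfolding chain_free_def
    proof
      assume "\<exists>C\<in>chains (\<A> - {U}). card C = s + 1"
      then obtain C where C: "C \<in> chains (\<A> - {U})" "card C = s + 1" by blast
      have "insert U C \<in> chains \<A>"
        using C(1) True Suc.prems(5) by (auto simp: chains_def chain_subset_def)
      moreover have "card (insert U C) = t + 1"
        using C by (subst card_insert_disjoint) (auto simp: t chains_def)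
      ultimately show False using Suc.prems(4) by (auto simp: chain_free_def)
    qed
    then have "(\<Sum>W\<in>\<A> - {U}. flag_prob ?q ?n ?a (vec.dim W)) \<le> real s"
      by (rule main) auto
    moreover have "flag_prob ?q ?n ?a ?a = 1"
      using q_fact_pos[OF q2] by (simp add: flag_prob_def less_imp_neq[symmetric])
    ultimately show ?thesis
      using True by (simp add: t sum.remove)
  qed
qed

section \<open>Symmetry and recursion of the weights\<close>

lemma prod_pairs_Cons:
  "(\<Prod>j<length (x # xs). \<Prod>i<j. real q ^ ((x # xs) ! i * (x # xs) ! j))
     = real q ^ (x * sum_list xs) * (\<Prod>j<length xs. \<Prod>i<j. real q ^ (xs ! i * xs ! j))"
proof -
  have "x * sum_list xs = (\<Sum>j<length xs. x * xs ! j)"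
    by (simp add: sum_list_sum_nth atLeast0LessThan sum_distrib_left)
  then show ?thesis
    by (simp add: prod.lessThan_Suc_shift prod.distrib power_sum del: prod.lessThan_Suc)
qed

lemma prod_pairs_snoc:
  "(\<Prod>j<length (xs @ [x]). \<Prod>i<j. real q ^ ((xs @ [x]) ! i * (xs @ [x]) ! j))
     = real q ^ (x * sum_list xs) * (\<Prod>j<length xs. \<Prod>i<j. real q ^ (xs ! i * xs ! j))"
proof -
  have "x * sum_list xs = (\<Sum>j<length xs. xs ! j * x)"
    by (simp add: sum_list_sum_nth atLeast0LessThan sum_distrib_left mult.commute)
  then show ?thesis
    by (simp add: nth_append power_sum mult.commute)
qed

text \<open>Moving the head \<open>x\<close> to the end leaves the other pairs alone, and the pairs
  with \<open>x\<close> contribute \<open>q ^ (x * sum_list xs)\<close> in either position.\<close>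

lemma weight_rotate: "weight q n (rotate m a) = weight q n a"
proof (induction m)
  case 0
  then show ?case by simp
next
  case (Suc m)
  have "weight q n (rotate1 b) = weight q n b" for b
  proof (cases b)
    case Nil
    then show ?thesis by simp
  next
    case (Cons x xs)
    have "(\<Prod>i<length (x # xs). q_fact q ((x # xs) ! i)) = q_fact q x * (\<Prod>i<length xs. q_fact q (xs ! i))"
      by (simp add: prod.lessThan_Suc_shift del: prod.lessThan_Suc)
    also have "\<dots> = (\<Prod>i<length (xs @ [x]). q_fact q ((xs @ [x]) ! i))"
      by (simp add: nth_append)
    finally show ?thesis
      unfolding Cons weight_def q_multinomial_def rotate1.simps prod_pairs_snoc prod_pairs_Cons
      by simp
  qed
  then show ?case using Suc by (simp add: rotate_Suc)
qed

text \<open>With \<open>n = x + sum_list xs\<close>, \<open>flag_prob q n 0 x\<close> is the inverse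
  of a Gaussian binomial coefficient, and the power of \<open>q\<close> is the bound on the number
  of complements of an \<open>x\<close>-dimensional subspace.\<close>

lemma inverse_weight_Cons:
  assumes "2 \<le> q"
  shows "1 / weight q (x + sum_list xs) (x # xs)
    = flag_prob q (x + sum_list xs) 0 x / real q ^ (x * sum_list xs) * (1 / weight q (sum_list xs) xs)"
proof -
  have "q_fact q m \<noteq> 0" for m using q_fact_pos[OF assms, of m] by simp
  moreover have "(\<Prod>i<length (x # xs). q_fact q ((x # xs) ! i))
      = q_fact q x * (\<Prod>i<length xs. q_fact q (xs ! i))"
    by (simp add: prod.lessThan_Suc_shift del: prod.lessThan_Suc)
  ultimately show ?thesis
    unfolding weight_def q_multinomial_def prod_pairs_Cons flag_prob_def
    by (simp add: field_simps)
qed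

lemma weight_pos:
  assumes "2 \<le> q"
  shows "0 < weight q n a"
  using assms by (auto simp: weight_def q_multinomial_def intro!: mult_pos_pos divide_pos_pos prod_pos q_fact_pos)

section \<open>Direct sums and decompositions\<close>

text \<open>Over a finite field this is equivalent to the decomposition property, and unlike the latter
  it is visibly invariant under permutations of the summands.\<close>

definition direct_sum :: "('a::field ^ 'n) set \<Rightarrow> ('a ^ 'n) set list \<Rightarrow> bool" where
  "direct_sum V Us \<longleftrightarrow> (\<forall>U \<in> set Us. vec.subspace U) \<and> vec.span (\<Union> (set Us)) = V
     \<and> sum_list (map vec.dim Us) = vec.dim V"

text \<open>The dimension formula gives \<open>dim W \<ge> dim V - dim U\<close>, and subadditivity
  of the dimension gives the reverse inequality. Equality makes \<open>U \<inter> W\<close> trivial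
  and the tail a direct sum in \<open>W\<close>.\<close>

lemma direct_sum_Cons:
  fixes U V :: "('a::field ^ 'n::finite) set"
  assumes "direct_sum V (U # Us)"
  defines "W \<equiv> vec.span (\<Union> (set Us))"
  shows "vec.subspace U" "W \<in> complements V U" "direct_sum W Us"
    "sum_list (map vec.dim Us) = vec.dim V - vec.dim U" "vec.dim U \<le> vec.dim V"
proof -
  have sub: "vec.subspace U" "\<forall>X \<in> set Us. vec.subspace X"
    and V: "vec.span (U \<union> \<Union> (set Us)) = V"
    and dims: "vec.dim U + sum_list (map vec.dim Us) = vec.dim V"
    using assms by (auto simp: direct_sum_def)
  have W: "vec.subspace W" by (simp add: W_def)
  have VUW: "vec.span (U \<union> W) = V"
    unfolding V[symmetric] W_def by (simp add: vec.span_Un vec.span_span)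
  have "vec.dim V + vec.dim (U \<inter> W) = vec.dim U + vec.dim W"
    using dim_span_Un_Int[OF sub(1) W] by (simp only: VUW)
  moreover have "vec.dim W \<le> sum_list (map vec.dim Us)"
    unfolding W_def by (rule dim_span_Union_le[OF sub(2)])
  ultimately have "vec.dim (U \<inter> W) = 0" and dimW: "vec.dim W = sum_list (map vec.dim Us)"
    using dims by linarith+
  then have "U \<inter> W = {0}"
    using vec.subspace_0[OF sub(1)] vec.subspace_0[OF W] by auto
  then show "W \<in> complements V U"
    using W VUW by (simp add: complements_def)
  show "direct_sum W Us"
    using sub dimW by (simp add: direct_sum_def W_def)
  show "vec.subspace U" by (rule sub)
  show "sum_list (map vec.dim Us) = vec.dim V - vec.dim U" "vec.dim U \<le> vec.dim V"
    using dims by auto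
qed

lemma mset_rotate: "mset (rotate m xs) = mset xs"
  by (metis append_take_drop_id mset_append rotate_drop_take union_commute)

lemma direct_sum_rotate: "direct_sum V (rotate m Us) \<longleftrightarrow> direct_sum V Us"
proof -
  have "sum_list (map vec.dim (rotate m Us)) = sum_list (map vec.dim Us)"
    by (metis mset_map mset_rotate sum_mset_sum_list)
  then show ?thesis by (simp add: direct_sum_def)
qed

lemma card_list_all2_subspaces:
  fixes Us :: "('a::{field,finite} ^ 'n::finite) set list"
  assumes "\<forall>U \<in> set Us. vec.subspace U"
  shows "card {vs. list_all2 (\<in>) vs Us} = CARD('a) ^ sum_list (map vec.dim Us)"
  using assms
proof (induction Us)
  case Nil
  then show ?case by simp
next
  case (Cons U Us)
  have "{vs. list_all2 (\<in>) vs (U # Us)} = (\<lambda>(v, vs). v # vs) ` (U \<times> {vs. list_all2 (\<in>) vs Us})"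
    by (auto simp: list_all2_Cons2)
  moreover have "inj_on (\<lambda>(v, vs). v # vs) (U \<times> {vs. list_all2 (\<in>) vs Us})"
    by (auto intro!: inj_onI)
  ultimately have "card {vs. list_all2 (\<in>) vs (U # Us)} = card U * card {vs. list_all2 (\<in>) vs Us}"
    by (simp add: card_image card_cartesian_product)
  then show ?case
    using Cons by (simp add: card_subspace power_add)
qed

text \<open>Existence and uniqueness make \<open>sum_list\<close> a bijection from the tuples of
  components onto the space. Both sides have a power of the field size as cardinality, and comparing
  exponents gives the dimension identity.\<close>

lemma direct_sum_of_decomposition:
  fixes Ds :: "('a::{field,finite} ^ 'n::finite) set list"
  assumes "is_decomposition r Ds"
  shows "direct_sum UNIV Ds"
proof -
  have sub: "\<forall>U \<in> set Ds. vec.subspace U"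
    and ex: "\<And>v. \<exists>!vs. list_all2 (\<in>) vs Ds \<and> sum_list vs = v"
    using assms by (auto simp: is_decomposition_def)
  have in_span: "sum_list vs \<in> vec.span (\<Union> (set Us))" if "list_all2 (\<in>) vs Us"
    for vs and Us :: "('a ^ 'n) set list"
    using that
  proof (induction rule: list_all2_induct)
    case Nil
    then show ?case by (simp add: vec.span_zero)
  next
    case (Cons v vs U Us)
    then have "v \<in> vec.span (\<Union> (set (U # Us)))" by (intro vec.span_base) auto
    moreover have "sum_list vs \<in> vec.span (\<Union> (set (U # Us)))"
      using Cons by (auto intro: vec.span_mono[THEN subsetD, rotated])
    ultimately show ?case by (simp add: vec.span_add)
  qed
  have "v \<in> vec.span (\<Union> (set Ds))" for v
    using ex1_implies_ex[OF ex[of v]] in_span by auto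
  then have span: "vec.span (\<Union> (set Ds)) = UNIV" by auto
  have dim_le: "vec.dim (UNIV :: ('a ^ 'n) set) \<le> sum_list (map vec.dim Ds)"
    using dim_span_Union_le[OF sub] by (simp only: span)
  have "bij_betw sum_list {vs. list_all2 (\<in>) vs Ds} UNIV"
    unfolding bij_betw_def
  proof
    show "inj_on sum_list {vs. list_all2 (\<in>) vs Ds}"
      by (rule inj_onI) (metis (mono_tags) ex mem_Collect_eq)
    show "sum_list ` {vs. list_all2 (\<in>) vs Ds} = UNIV"
      using ex1_implies_ex[OF ex] by (auto simp: image_iff) metis
  qed
  then have "card {vs. list_all2 (\<in>) vs Ds} = CARD('a ^ 'n)"
    by (rule bij_betw_same_card)
  then have "CARD('a) ^ sum_list (map vec.dim Ds) = CARD('a) ^ vec.dim (UNIV :: ('a ^ 'n) set)"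
    using card_subspace[of "UNIV :: ('a ^ 'n) set"]
    by (simp only: card_list_all2_subspaces[OF sub]) simp
  then have "sum_list (map vec.dim Ds) = vec.dim (UNIV :: ('a ^ 'n) set)"
    using card_field_ge_2[where 'a = 'a] by (subst (asm) power_inject_exp) auto
  then show ?thesis using sub span by (simp add: direct_sum_def)
qed

section \<open>The LYM inequality for families of direct sums\<close>

lemma finite_lists_of_sets:
  assumes "\<forall>Ds \<in> \<D>. length Ds = r"
  shows "finite (\<D> :: ('a::finite) set list set)"
  by (rule finite_subset[OF _ finite_lists_length_eq[of "UNIV :: 'a set set" r]]) (use assms in auto)

text \<open>The last summand is determined up to choosing complements, so no chain condition is needed
  for it.\<close>

lemma LYM_direct_sums:
  fixes V :: "('a::{field,finite} ^ 'n::finite) set"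
  assumes "vec.subspace V"
    and "\<forall>Ds \<in> \<D>. length Ds = Suc (length ts) \<and> direct_sum V Ds"
    and "\<forall>k < length ts. chain_free (ts ! k) (component \<D> k)"
  shows "(\<Sum>Ds\<in>\<D>. 1 / weight CARD('a) (vec.dim V) (map vec.dim Ds)) \<le> real (prod_list ts)"
  using assms
proof (induction ts arbitrary: V \<D>)
  case Nil
  note q2 = card_field_ge_2[where 'a = 'a]
  \<comment> \<open>A lone summand must be \<open>V\<close>, so there is at most one tuple, of
    weight 1; the empty product on the right is also 1.\<close>
  have "Ds = [V]" if Ds: "Ds \<in> \<D>" for Ds
  proof -
    obtain U where "Ds = [U]" using Nil Ds by (auto simp: length_Suc_conv)
    then show ?thesis using Nil Ds by (auto simp: direct_sum_def vec.span_eq_iff[THEN iffD2])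
  qed
  then have sub: "\<D> \<subseteq> {[V]}" by blast
  have one: "weight CARD('a) (vec.dim V) [vec.dim V] = 1"
    using q_fact_pos[OF q2, of "vec.dim V"] by (simp add: weight_def q_multinomial_def)
  have "(\<Sum>Ds\<in>\<D>. 1 / weight CARD('a) (vec.dim V) (map vec.dim Ds))
      \<le> (\<Sum>Ds\<in>{[V]}. 1 / weight CARD('a) (vec.dim V) (map vec.dim Ds))"
    using sub one by (intro sum_mono2) (auto simp: less_imp_le weight_pos[OF q2])
  also have "\<dots> = 1" by (simp add: one)
  finally show ?case by simp
next
  case (Cons t ts)
  let ?q = "CARD('a)" and ?n = "vec.dim V"
  let ?F = "\<lambda>Ds. 1 / weight ?q ?n (map vec.dim Ds)"
  let ?tail = "\<lambda>Ds. vec.span (\<Union> (set (tl Ds)))"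
  note q2 = card_field_ge_2[where 'a = 'a]
  have fin: "finite \<D>"
    using Cons.prems(2) by (intro finite_lists_of_sets) auto
  have dec: "direct_sum V (U # Us)" "length Us = Suc (length ts)" if "U # Us \<in> \<D>" for U Us
    using Cons.prems(2) that by auto
  have split: "\<exists>U Us. Ds = U # Us" if "Ds \<in> \<D>" for Ds
    using Cons.prems(2) that by (cases Ds) auto
  have tail: "?tail Ds \<in> complements V (Ds ! 0)" if "Ds \<in> \<D>" for Ds
    using split[OF that] that direct_sum_Cons(2) dec by fastforce
  have head: "vec.subspace U" "vec.dim U \<le> ?n" "U \<subseteq> V" if U: "U \<in> component \<D> 0" for U
  proof -
    obtain Ds where Ds: "Ds \<in> \<D>" "U = Ds ! 0" using U by (auto simp: component_def)
    then obtain Us where "U # Us \<in> \<D>" using split[OF Ds(1)] by auto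
    note head_tail = direct_sum_Cons[OF dec(1)[OF this]]
    show "vec.subspace U" "vec.dim U \<le> ?n" by (rule head_tail)+
    show "U \<subseteq> V" using head_tail(2) vec.span_superset by (fastforce simp: complements_def)
  qed
  \<comment> \<open>With the first summand \<open>U\<close> and the span \<open>W\<close> of the
    others fixed, the tails are direct sums in \<open>W\<close>. Their components lie in those of
    \<open>\<D>\<close> with the index shifted by one, so the induction hypothesis applies.\<close>
  have fiber: "(\<Sum>Ds | Ds \<in> {Ds \<in> \<D>. Ds ! 0 = U} \<and> ?tail Ds = W. ?F Ds)
      \<le> flag_prob ?q ?n 0 (vec.dim U) / real ?q ^ (vec.dim U * (?n - vec.dim U)) * real (prod_list ts)"
    (is "?L \<le> ?c * _") if U: "U \<in> component \<D> 0" and W: "W \<in> complements V U" for U W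
  proof -
    define \<E> where "\<E> = {Us. U # Us \<in> \<D> \<and> vec.span (\<Union> (set Us)) = W}"
    have dimW: "vec.dim W = ?n - vec.dim U"
    proof -
      have W': "vec.subspace W" "U \<inter> W = {0}" "vec.span (U \<union> W) = V"
        using W by (auto simp: complements_def)
      have "vec.dim V + vec.dim {0 :: 'a ^ 'n} = vec.dim U + vec.dim W"
        using dim_span_Un_Int[OF head(1)[OF U] W'(1)] by (simp only: W'(2,3))
      then show ?thesis by simp
    qed
    have "{Ds. Ds \<in> {Ds \<in> \<D>. Ds ! 0 = U} \<and> ?tail Ds = W} = (#) U ` \<E>"
      unfolding \<E>_def using split by fastforce
    then have "?L = (\<Sum>Us\<in>\<E>. ?F (U # Us))"
      by (simp add: sum.reindex inj_on_def)
    also have "\<dots> = (\<Sum>Us\<in>\<E>. ?c * (1 / weight ?q (vec.dim W) (map vec.dim Us)))"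
    proof (rule sum.cong[OF refl])
      fix Us assume "Us \<in> \<E>"
      then have sum: "sum_list (map vec.dim Us) = ?n - vec.dim U"
        using direct_sum_Cons(4)[OF dec(1)] by (simp add: \<E>_def)
      show "?F (U # Us) = ?c * (1 / weight ?q (vec.dim W) (map vec.dim Us))"
        using inverse_weight_Cons[OF q2, of "vec.dim U" "map vec.dim Us"] head(2)[OF U]
        by (simp add: sum dimW)
    qed
    also have "\<dots> = ?c * (\<Sum>Us\<in>\<E>. 1 / weight ?q (vec.dim W) (map vec.dim Us))"
      by (simp only: sum_distrib_left)
    also have "\<dots> \<le> ?c * real (prod_list ts)"
    proof (rule mult_left_mono)
      show "(\<Sum>Us\<in>\<E>. 1 / weight ?q (vec.dim W) (map vec.dim Us)) \<le> real (prod_list ts)"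
      proof (rule Cons.IH)
        show "vec.subspace W" using W by (simp add: complements_def)
        show "\<forall>Us \<in> \<E>. length Us = Suc (length ts) \<and> direct_sum W Us"
          using dec direct_sum_Cons(3)[OF dec(1)] by (auto simp: \<E>_def)
        show "\<forall>k < length ts. chain_free (ts ! k) (component \<E> k)"
        proof (intro allI impI)
          fix k assume "k < length ts"
          then have "chain_free ((t # ts) ! Suc k) (component \<D> (Suc k))"
            using Cons.prems(3)[rule_format, of "Suc k"] by simp
          moreover have "component \<E> k \<subseteq> component \<D> (Suc k)"
            by (force simp: component_def \<E>_def)
          ultimately show "chain_free (ts ! k) (component \<E> k)"
            using chain_free_mono by simp
        qed
      qed
      show "0 \<le> ?c"
        using q_fact_pos[OF q2] by (simp add: flag_prob_def less_imp_le)
    qed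
    finally show ?thesis .
  qed
  \<comment> \<open>Every tail spans a complement of \<open>U\<close>; the bound on the number of
    complements cancels the power of \<open>q\<close> in \<open>fiber\<close>.\<close>
  have fiber2: "(\<Sum>Ds | Ds \<in> \<D> \<and> Ds ! 0 = U. ?F Ds) \<le> flag_prob ?q ?n 0 (vec.dim U) * real (prod_list ts)"
    if U: "U \<in> component \<D> 0" for U
  proof -
    let ?Q = "?q ^ (vec.dim U * (?n - vec.dim U))"
    let ?p = "flag_prob ?q ?n 0 (vec.dim U)"
    have p0: "0 \<le> ?p / real ?Q * real (prod_list ts)"
      using q_fact_pos[OF q2] by (simp add: flag_prob_def less_imp_le)
    have "(\<Sum>Ds | Ds \<in> \<D> \<and> Ds ! 0 = U. ?F Ds)
        = (\<Sum>W\<in>complements V U. \<Sum>Ds | Ds \<in> {Ds \<in> \<D>. Ds ! 0 = U} \<and> ?tail Ds = W. ?F Ds)"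
      by (rule sum.group[symmetric]) (use fin tail in auto)
    also have "\<dots> \<le> real (card (complements V U)) * (?p / real ?Q * real (prod_list ts))"
      using fiber[OF U] by (intro sum_bounded_above) simp
    also have "\<dots> \<le> real ?Q * (?p / real ?Q * real (prod_list ts))"
      using card_complements_le[OF head(1)[OF U]] p0 by (intro mult_right_mono of_nat_mono)
    also have "\<dots> = ?p * real (prod_list ts)"
      using q2 by simp
    finally show ?thesis .
  qed
  have "(\<Sum>Ds\<in>\<D>. ?F Ds) = (\<Sum>U\<in>component \<D> 0. \<Sum>Ds | Ds \<in> \<D> \<and> Ds ! 0 = U. ?F Ds)"
    by (rule sum.group[symmetric]) (use fin in \<open>auto simp: component_def\<close>)
  also have "\<dots> \<le> (\<Sum>U\<in>component \<D> 0. flag_prob ?q ?n 0 (vec.dim U) * real (prod_list ts))"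
    by (rule sum_mono) (rule fiber2)
  also have "\<dots> = (\<Sum>U\<in>component \<D> 0. flag_prob ?q ?n 0 (vec.dim U)) * real (prod_list ts)"
    by (simp only: sum_distrib_right)
  \<comment> \<open>The first components lie between \<open>{0}\<close> and \<open>V\<close>, so
    \<open>LYM_between\<close> applies with bottom dimension 0.\<close>
  also have "\<dots> \<le> real t * real (prod_list ts)"
  proof (rule mult_right_mono)
    have "chain_free t (component \<D> 0)" using Cons.prems(3) by auto
    then show "(\<Sum>U\<in>component \<D> 0. flag_prob ?q ?n 0 (vec.dim U)) \<le> real t"
      using LYM_between[of "{0}" V t "component \<D> 0"] Cons.prems(1) head
      by (simp add: vec.subspace_0)
  qed simp
  finally show ?case by simp
qed

text \<open>Rotating the tuples moves the index with the largest \<open>t\<close> to the last position, where it does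
  not contribute.\<close>

lemma LYM_sigma:
  fixes \<D> :: "('a::{field,finite} ^ 'n::finite) set list set"
  assumes "ts \<noteq> []" "\<forall>t \<in> set ts. t > 0"
    and dec: "\<forall>Ds \<in> \<D>. length Ds = length ts \<and> direct_sum UNIV Ds"
    and free: "\<forall>k < length ts. chain_free (ts ! k) (component \<D> k)"
  shows "(\<Sum>Ds\<in>\<D>. 1 / weight CARD('a) CARD('n) (map vec.dim Ds)) \<le> real (sigma ts)"
proof -
  define r where "r = length ts"
  have "Max (set ts) \<in> set ts" using assms(1) by (intro Max_in) auto
  then obtain m where m: "m < r" "ts ! m = Max (set ts)" by (auto simp: in_set_conv_nth r_def)
  \<comment> \<open>Rotating by \<open>m\<close> would bring index \<open>m\<close> to the front;
    one further step sends it to the end.\<close>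
  define us where "us = rotate (Suc m) ts"
  have len: "length us = r" "us \<noteq> []" using assms(1) by (auto simp: us_def r_def)
  have nth_us: "us ! k = ts ! ((Suc m + k) mod r)" if "k < r" for k
    using that nth_rotate[of k ts "Suc m"] by (simp add: us_def r_def)
  have "last us = us ! (r - 1)" using len by (simp add: last_conv_nth)
  also have "\<dots> = Max (set ts)" using nth_us[of "r - 1"] m by simp
  finally have last: "last us = Max (set ts)" .
  have "prod_list ts = prod_list us"
    unfolding us_def by (metis mset_rotate prod_mset_prod_list)
  also have "\<dots> = prod_list (butlast us @ [last us])"
    using len(2) by simp
  finally have "prod_list ts = prod_list (butlast us) * Max (set ts)"
    by (simp only: prod_list.append last) simp
  moreover have "Max (set ts) > 0" using assms(2) \<open>Max (set ts) \<in> set ts\<close> by blast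
  ultimately have \<sigma>: "sigma ts = prod_list (butlast us)"
    by (simp add: sigma_def)
  define \<E> where "\<E> = rotate (Suc m) ` \<D>"
  have inj: "inj_on (rotate (Suc m)) \<D>"
    unfolding rotate_def by (rule inj_on_subset[OF inj_fn[OF inj_rotate1]]) simp
  have "chain_free (butlast us ! k) (component \<E> k)" if "k < length (butlast us)" for k
  proof -
    have k: "k < r" using that len by simp
    have "component \<E> k = component \<D> ((Suc m + k) mod r)"
      unfolding component_def \<E>_def image_image
    proof (rule image_cong[OF refl])
      fix Ds assume "Ds \<in> \<D>"
      then have "length Ds = r" using dec by (simp add: r_def)
      then show "rotate (Suc m) Ds ! k = Ds ! ((Suc m + k) mod r)"
        using nth_rotate[of k Ds "Suc m"] k by simp
    qed
    moreover have "butlast us ! k = ts ! ((Suc m + k) mod r)"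
      using that nth_us[OF k] by (simp add: nth_butlast)
    moreover have "(Suc m + k) mod r < length ts" using assms(1) by (simp add: r_def)
    ultimately show ?thesis using free by simp
  qed
  moreover have "\<forall>Ds \<in> \<E>. length Ds = Suc (length (butlast us)) \<and> direct_sum UNIV Ds"
    using dec len m(1) by (auto simp: \<E>_def direct_sum_rotate r_def simp del: rotate_Suc)
  ultimately have "(\<Sum>Ds\<in>\<E>. 1 / weight CARD('a) (vec.dim (UNIV :: ('a ^ 'n) set)) (map vec.dim Ds))
      \<le> real (prod_list (butlast us))"
    by (intro LYM_direct_sums) auto
  then show ?thesis
    unfolding \<sigma> \<E>_def sum.reindex[OF inj] o_def rotate_map[symmetric] weight_rotate vec_dim_card .
qed

section \<open>From the weighted inequality to the cardinality bound\<close>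

text \<open>A fractional knapsack with unit costs and capacity \<open>s\<close>: full coefficients
  on the largest values are optimal.\<close>

lemma sum_weighted_le_sum_nth_largest:
  fixes w x :: "'b \<Rightarrow> real"
  assumes "finite S"
    and w: "\<And>a. a \<in> S \<Longrightarrow> 0 \<le> w a"
    and x: "\<And>a. a \<in> S \<Longrightarrow> 0 \<le> x a \<and> x a \<le> 1"
    and sum: "(\<Sum>a\<in>S. x a) \<le> real s"
  shows "(\<Sum>a\<in>S. x a * w a) \<le> (\<Sum>i<s. nth_largest (image_mset w (mset_set S)) i)"
proof -
  obtain ys where ys: "set ys = S" "distinct ys" using finite_distinct_list[OF assms(1)] by blast
  \<comment> \<open>Sorting the elements by \<open>w\<close>, rather than only their values,
    attaches an element of \<open>S\<close> to each position of the decreasing list.\<close>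
  define zs where "zs = rev (sort_key w ys)"
  define N where "N = length zs"
  have zs: "set zs = S" "distinct zs" using ys by (auto simp: zs_def)
  have sorted: "sorted (rev (map w zs))" by (simp add: zs_def rev_map)
  have M: "image_mset w (mset_set S) = mset (map w zs)"
    using zs mset_set_set by fastforce
  have "sort (map w zs) = rev (map w zs)"
    by (rule properties_for_sort) (use sorted in auto)
  then have L: "nth_largest (image_mset w (mset_set S)) i = (if i < N then w (zs ! i) else 0)" for i
    unfolding M nth_largest_def by (simp add: N_def rev_map del: mset_map)
  have reindex: "(\<Sum>a\<in>S. f a) = (\<Sum>i<N. f (zs ! i))" for f :: "'b \<Rightarrow> real"
    using sum.reindex_bij_betw[OF bij_betw_nth[of zs "{..<N}" S], of f] zs by (simp add: N_def)
  have mem: "zs ! i \<in> S" if "i < N" for i using that zs by (auto simp: N_def)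
  have anti: "w (zs ! j) \<le> w (zs ! i)" if "i \<le> j" "j < N" for i j
    using sorted that by (auto simp: sorted_rev_iff_nth_mono N_def)
  show ?thesis
  proof (cases "s < N")
    \<comment> \<open>All of \<open>S\<close> fits: each coefficient is bounded by 1, and positions
      from \<open>N\<close> on contribute 0.\<close>
    case False
    have "(\<Sum>a\<in>S. x a * w a) \<le> (\<Sum>a\<in>S. w a)"
      using w x by (intro sum_mono mult_left_le_one_le) auto
    also have "\<dots> = (\<Sum>i<N. nth_largest (image_mset w (mset_set S)) i)"
      by (simp add: reindex L)
    also have "\<dots> \<le> (\<Sum>i<s. nth_largest (image_mset w (mset_set S)) i)"
      using False by (intro sum_mono2) (auto simp: L w mem)
    finally show ?thesis .
  next
    case True
    \<comment> \<open>\<open>c\<close> is the first value left out, at zero-based position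
      \<open>s\<close>. The differences \<open>w (zs ! i) - c\<close> are nonnegative before
      \<open>s\<close> and nonpositive from there on, so coefficients 1 and then 0 maximize their
      sum.\<close>
    define c where "c = w (zs ! s)"
    have c: "0 \<le> c" using w mem True by (simp add: c_def)
    have "(\<Sum>a\<in>S. x a * w a) = (\<Sum>i<N. x (zs ! i) * (w (zs ! i) - c)) + c * (\<Sum>a\<in>S. x a)"
      by (simp add: reindex sum_distrib_left sum.distrib[symmetric] algebra_simps)
    also have "(\<Sum>i<N. x (zs ! i) * (w (zs ! i) - c)) \<le> (\<Sum>i<N. if i < s then w (zs ! i) - c else 0)"
    proof (rule sum_mono)
      fix i assume i: "i \<in> {..<N}"
      then have xi: "0 \<le> x (zs ! i)" "x (zs ! i) \<le> 1" using x mem by auto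
      show "x (zs ! i) * (w (zs ! i) - c) \<le> (if i < s then w (zs ! i) - c else 0)"
        using xi anti[of i s] anti[of s i] True i
        by (auto simp: c_def intro!: mult_left_le_one_le mult_nonneg_nonpos)
    qed
    also have "(\<Sum>i<N. if i < s then w (zs ! i) - c else 0) = (\<Sum>i<s. w (zs ! i) - c)"
      using True by (intro sum.mono_neutral_cong_right) auto
    also have "c * (\<Sum>a\<in>S. x a) \<le> c * real s"
      by (rule mult_left_mono[OF sum c])
    also have "(\<Sum>i<s. w (zs ! i) - c) + c * real s = (\<Sum>i<s. w (zs ! i))"
      by (simp add: sum_subtractf)
    also have "\<dots> = (\<Sum>i<s. nth_largest (image_mset w (mset_set S)) i)"
      using True by (simp add: L)
    finally show ?thesis by simp
  qed
qed

text \<open>Comparable subspaces of equal dimension coincide, while a chain of length 1 has two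
  distinct members.\<close>

lemma chain_free_1_same_dim:
  fixes \<A> :: "('a::field ^ 'n::finite) set set"
  assumes "\<And>U. U \<in> \<A> \<Longrightarrow> vec.subspace U \<and> vec.dim U = d"
  shows "chain_free 1 \<A>"
  unfolding chain_free_def
proof
  assume "\<exists>C\<in>chains \<A>. card C = 1 + 1"
  then obtain C U W where C: "C \<in> chains \<A>" "U \<in> C" "W \<in> C" "U \<noteq> W"
    by (auto simp: card_2_iff numeral_2_eq_2[symmetric])
  then have "U \<in> \<A>" "W \<in> \<A>" "U \<subseteq> W \<or> W \<subseteq> U"
    by (auto simp: chains_def chain_subset_def)
  then have "U = W"
    using assms vec.subspace_dim_equal[of U W] vec.subspace_dim_equal[of W U] by auto
  then show False using C(4) by simp
qed

theorem theorem4p1: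
  fixes q n r :: nat
    and ts :: "nat list"
    and \<D> :: "('a::{field,finite} ^ 'n::finite) set list set"
  assumes "q = CARD('a)" and "n = CARD('n)"
    and "r > 0"
    and "length ts = r" and "\<forall>t \<in> set ts. t > 0"
    and "\<forall>Ds \<in> \<D>. is_decomposition r Ds"
    and "\<forall>k < r. chain_free (ts ! k) (component \<D> k)"
  shows "(\<Sum>a \<in> weak_compositions r n. real (card (with_dims \<D> a)) / weight q n a)
           \<le> real (sigma ts)
         \<and> real (card \<D>)
           \<le> (\<Sum>i < sigma ts.
                nth_largest (image_mset (weight q n) (mset_set (weak_compositions r n))) i)"
proof -
  let ?C = "weak_compositions r n"
  have q2: "2 \<le> q" using card_field_ge_2[where 'a = 'a] assms(1) by simp
  have dec: "direct_sum UNIV Ds" "length Ds = r" if "Ds \<in> \<D>" for Ds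
  proof -
    have "is_decomposition r Ds" using assms(6) that by blast
    then show "direct_sum UNIV Ds" "length Ds = r"
      by (auto intro: direct_sum_of_decomposition) (simp add: is_decomposition_def)
  qed
  have fin: "finite \<D>"
    by (rule finite_lists_of_sets[where r = r]) (simp add: dec(2))
  have comp: "map vec.dim ` \<D> \<subseteq> ?C"
  proof (rule image_subsetI)
    fix Ds assume Ds: "Ds \<in> \<D>"
    have "sum_list (map vec.dim Ds) = vec.dim (UNIV :: ('a ^ 'n) set)"
      using dec(1)[OF Ds] by (simp only: direct_sum_def)
    then show "map vec.dim Ds \<in> ?C"
      unfolding weak_compositions_def vec_dim_card assms(2) using dec(2)[OF Ds] by simp
  qed
  have group: "(\<Sum>Ds\<in>\<D>. f Ds) = (\<Sum>a\<in>?C. \<Sum>Ds\<in>with_dims \<D> a. f Ds)"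
    for f :: "('a ^ 'n) set list \<Rightarrow> real"
    unfolding with_dims_def
    by (rule sum.group[symmetric]) (use fin finite_weak_compositions comp in auto)
  have inner: "(\<Sum>Ds\<in>with_dims \<D> a. 1 / weight q n (map vec.dim Ds))
      = real (card (with_dims \<D> a)) / weight q n a" for a
    by (simp add: with_dims_def)
  have "(\<Sum>Ds\<in>\<D>. 1 / weight q n (map vec.dim Ds)) \<le> real (sigma ts)"
    unfolding assms(1,2) by (rule LYM_sigma) (use assms(3-5,7) dec in auto)
  then have 1: "(\<Sum>a\<in>?C. real (card (with_dims \<D> a)) / weight q n a) \<le> real (sigma ts)"
    by (simp only: group inner)
  \<comment> \<open>Fixing the dimensions makes every component an antichain, so
    \<open>LYM_sigma\<close> applies with all chain lengths 1, for which \<open>sigma\<close> is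
    1.\<close>
  have le1: "real (card (with_dims \<D> a)) / weight q n a \<le> 1" for a
  proof -
    have "(\<Sum>Ds\<in>with_dims \<D> a. 1 / weight q n (map vec.dim Ds)) \<le> real (sigma (replicate r 1))"
      unfolding assms(1,2)
    proof (rule LYM_sigma)
      show "\<forall>k < length (replicate r (1 :: nat)).
          chain_free (replicate r 1 ! k) (component (with_dims \<D> a) k)"
      proof (intro allI impI)
        fix k assume "k < length (replicate r (1 :: nat))"
        then have k: "k < r" by simp
        have "chain_free 1 (component (with_dims \<D> a) k)"
        proof (rule chain_free_1_same_dim)
          fix U assume "U \<in> component (with_dims \<D> a) k"
          then obtain Ds where "Ds \<in> \<D>" "a = map vec.dim Ds" "U = Ds ! k"
            by (auto simp: component_def with_dims_def)
          then show "vec.subspace U \<and> vec.dim U = a ! k"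
            using dec[of Ds] k by (auto simp: direct_sum_def)
        qed
        then show "chain_free (replicate r 1 ! k) (component (with_dims \<D> a) k)"
          using k by simp
      qed
    qed (use assms(3) dec in \<open>auto simp: with_dims_def\<close>)
    also have "sigma (replicate r 1) = 1"
      using assms(3) by (simp add: sigma_def)
    finally show ?thesis by (simp only: inner of_nat_1)
  qed
  have "real (card \<D>) = (\<Sum>a\<in>?C. real (card (with_dims \<D> a)))"
    using group[of "\<lambda>_. 1"] by simp
  also have "\<dots> = (\<Sum>a\<in>?C. real (card (with_dims \<D> a)) / weight q n a * weight q n a)"
    using weight_pos[OF q2] by (simp add: less_imp_neq[symmetric])
  also have "\<dots> \<le> (\<Sum>i < sigma ts. nth_largest (image_mset (weight q n) (mset_set ?C)) i)"
    by (rule sum_weighted_le_sum_nth_largest[OF finite_weak_compositions _ _ 1])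
      (use weight_pos[OF q2] le1 in \<open>auto simp: less_imp_le intro!: divide_nonneg_pos\<close>)
  finally show ?thesis using 1 by blast
qed

end
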